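(* Let $\langle\mathbf{A},\forall,\exists\rangle$ be an Epistemic BL-algebra whose BL-reduct $\mathbf{A}$ is a Gödel algebra. Then for all $a,b\in A$: (G1) $\forall(a\ast b)=\forall a\ast\forall b$; (G2) $\forall 1=1$; (G3) $\exists a\to\forall b\le\forall(a\to b)$; (G4) $\exists(a\vee b)=\exists a\vee\exists b$; (G5) $\exists 0=0$; (G6) $\exists(a\to b)\le\forall a\to\exists b$; (G7) $\forall a\le\exists a$; (G8) $\forall a\le\forall\forall a$ and $\exists a\le\exists\exists a$; (G9) $\exists a\le\forall\exists a$ and $\exists\forall a\le\forall a$. That is, $\langle\mathbf{A},\forall,\exists\rangle$ is a bi-modal Gödel algebra.
   Context: A BL-algebra is an algebra $\langle A,\wedge,\vee,\ast,\to,0,1\rangle$ such that $\langle A,\wedge,\vee,0,1\rangle$ is a bounded lattice (order $\le$), $\langle A,\ast,1\rangle$ is a commutative monoid, $a\ast b\le c$ iff $a\le b\to c$, and $a\wedge b=a\ast(a\to b)$ and $(a\to b)\vee(b\to a)=1$ hold. A Gödel algebra is a BL-algebra satisfying $a\ast b=a\wedge b$. An Epistemic BL-algebra is a BL-algebra with unary operations $\forall,\exists$ satisfying, for all $a,b$: $\forall 1=1$; $\exists 0=0$; $\forall a\to\exists a=1$; $\forall(a\to\forall b)=\exists a\to\forall b$; $\forall(\forall a\to b)=\forall a\to\forall b$; $\exists a\to\forall\exists a=1$; $\forall(a\wedge b)=\forall a\wedge\forall b$; $\exists(a\vee b)=\exists a\vee\exists b$; $\exists(a\ast\exists b)=\exists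 a\ast\exists b$. A bi-modal Gödel algebra is a Gödel algebra with unary operations $\forall,\exists$ satisfying (G1)–(G9) as listed in the claim. *)

theory Defs
  imports Main
begin

unbundle lattice_syntax

text \<open>The universe of an algebra is a whole type; its bounded lattice structure
  (with order, \<open>0 = \<bottom>\<close> and \<open>1 = \<top>\<close>) is that of the class \<^class>\<open>bounded_lattice\<close>.\<close>

locale bl_algebra = comm_monoid mult top
  for mult :: "'a::bounded_lattice \<Rightarrow> 'a \<Rightarrow> 'a"  (infixl \<open>\<^bold>*\<close> 70) +
  fixes imp :: "'a \<Rightarrow> 'a \<Rightarrow> 'a"  (infixr \<open>\<^bold>\<rightarrow>\<close> 60)
  assumes residuation: "a \<^bold>* b \<le> c \<longleftrightarrow> a \<le> b \<^bold>\<rightarrow> c"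
    and divisibility: "a \<sqinter> b = a \<^bold>* (a \<^bold>\<rightarrow> b)"
    and prelinearity: "(a \<^bold>\<rightarrow> b) \<squnion> (b \<^bold>\<rightarrow> a) = \<top>"

locale godel_algebra = bl_algebra +
  assumes mult_eq_inf: "a \<^bold>* b = a \<sqinter> b"

locale epistemic_bl_algebra = bl_algebra mult imp
  for mult :: "'a::bounded_lattice \<Rightarrow> 'a \<Rightarrow> 'a"  (infixl \<open>\<^bold>*\<close> 70)
    and imp :: "'a \<Rightarrow> 'a \<Rightarrow> 'a"  (infixr \<open>\<^bold>\<rightarrow>\<close> 60) +
  fixes univ :: "'a \<Rightarrow> 'a"  (\<open>\<^bold>\<forall>_\<close> [90] 90)
    and exis :: "'a \<Rightarrow> 'a"  (\<open>\<^bold>\<exists>_\<close> [90] 90)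
  assumes univ_top: "\<^bold>\<forall>\<top> = \<top>"
    and exis_bot: "\<^bold>\<exists>\<bottom> = \<bottom>"
    and univ_imp_exis: "\<^bold>\<forall>a \<^bold>\<rightarrow> \<^bold>\<exists>a = \<top>"
    and univ_imp_univ: "\<^bold>\<forall>(a \<^bold>\<rightarrow> \<^bold>\<forall>b) = \<^bold>\<exists>a \<^bold>\<rightarrow> \<^bold>\<forall>b"
    and univ_univ_imp: "\<^bold>\<forall>(\<^bold>\<forall>a \<^bold>\<rightarrow> b) = \<^bold>\<forall>a \<^bold>\<rightarrow> \<^bold>\<forall>b"
    and exis_imp_univ_exis: "\<^bold>\<exists>a \<^bold>\<rightarrow> \<^bold>\<forall>\<^bold>\<exists>a = \<top>"
    and univ_inf: "\<^bold>\<forall>(a \<sqinter> b) = \<^bold>\<forall>a \<sqinter> \<^bold>\<forall>b"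
    and exis_sup: "\<^bold>\<exists>(a \<squnion> b) = \<^bold>\<exists>a \<squnion> \<^bold>\<exists>b"
    and exis_mult_exis: "\<^bold>\<exists>(a \<^bold>* \<^bold>\<exists>b) = \<^bold>\<exists>a \<^bold>* \<^bold>\<exists>b"

locale bimodal_godel_algebra = godel_algebra mult imp
  for mult :: "'a::bounded_lattice \<Rightarrow> 'a \<Rightarrow> 'a"  (infixl \<open>\<^bold>*\<close> 70)
    and imp :: "'a \<Rightarrow> 'a \<Rightarrow> 'a"  (infixr \<open>\<^bold>\<rightarrow>\<close> 60) +
  fixes univ :: "'a \<Rightarrow> 'a"  (\<open>\<^bold>\<forall>_\<close> [90] 90)
    and exis :: "'a \<Rightarrow> 'a"  (\<open>\<^bold>\<exists>_\<close> [90] 90)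
  assumes G1: "\<^bold>\<forall>(a \<^bold>* b) = \<^bold>\<forall>a \<^bold>* \<^bold>\<forall>b"
    and G2: "\<^bold>\<forall>\<top> = \<top>"
    and G3: "\<^bold>\<exists>a \<^bold>\<rightarrow> \<^bold>\<forall>b \<le> \<^bold>\<forall>(a \<^bold>\<rightarrow> b)"
    and G4: "\<^bold>\<exists>(a \<squnion> b) = \<^bold>\<exists>a \<squnion> \<^bold>\<exists>b"
    and G5: "\<^bold>\<exists>\<bottom> = \<bottom>"
    and G6: "\<^bold>\<exists>(a \<^bold>\<rightarrow> b) \<le> \<^bold>\<forall>a \<^bold>\<rightarrow> \<^bold>\<exists>b"
    and G7: "\<^bold>\<forall>a \<le> \<^bold>\<exists>a"
    and G8: "\<^bold>\<forall>a \<le> \<^bold>\<forall>\<^bold>\<forall>a" "\<^bold>\<exists>a \<le> \<^bold>\<exists>\<^bold>\<exists>a"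
    and G9: "\<^bold>\<exists>a \<le> \<^bold>\<forall>\<^bold>\<exists>a" "\<^bold>\<exists>\<^bold>\<forall>a \<le> \<^bold>\<forall>a"

end

theory Submission
  imports Defs
begin

text \<open>
  Neither \<open>\<^bold>\<forall>a \<le> a\<close> nor \<open>a \<le> \<^bold>\<exists>a\<close> is available, but both hold ``necessarily'':
  \<open>\<^bold>\<forall>(\<^bold>\<forall>a \<^bold>\<rightarrow> a) = \<top>\<close> and \<open>\<^bold>\<forall>(a \<^bold>\<rightarrow> \<^bold>\<exists>a) = \<top>\<close>.  As \<open>\<^bold>\<forall>\<close> preserves
  meets, the elements \<open>x\<close> with \<open>\<^bold>\<forall>x = \<top>\<close> form a filter, so (G3) and (G6) can be
  derived under \<open>\<^bold>\<forall>\<close> by intuitionistic reasoning from these two facts, and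
  then pulled out because \<open>\<^bold>\<forall>\<close> and \<open>\<^bold>\<exists>\<close> have the same fixed points.
\<close>

context bl_algebra
begin

lemma imp_eq_top_iff: "a \<^bold>\<rightarrow> b = \<top> \<longleftrightarrow> a \<le> b"
  by (metis residuation left_neutral top_le top_greatest)

end

context epistemic_bl_algebra
begin

lemma univ_mono: "a \<le> b \<Longrightarrow> \<^bold>\<forall>a \<le> \<^bold>\<forall>b"
  by (metis univ_inf le_iff_inf)

lemma univ_le_exis: "\<^bold>\<forall>a \<le> \<^bold>\<exists>a"
  using univ_imp_exis imp_eq_top_iff by blast

lemma exis_le_univ_exis: "\<^bold>\<exists>a \<le> \<^bold>\<forall>\<^bold>\<exists>a"
  using exis_imp_univ_exis imp_eq_top_iff by blast

text \<open>Here and in \<open>univ_le_univ_univ\<close>, the element \<forall>(\<forall>a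
  \<rightarrow> \<forall>a) = \<forall>\<top> = \<top> is expanded: by \<open>univ_imp_univ\<close>
  it is \<exists>\<forall>a \<rightarrow> \<forall>a, by \<open>univ_univ_imp\<close> it is
  \<forall>a \<rightarrow> \<forall>\<forall>a.\<close>

lemma exis_univ_le: "\<^bold>\<exists>\<^bold>\<forall>a \<le> \<^bold>\<forall>a"
  by (metis univ_imp_univ univ_top imp_eq_top_iff order_refl)

lemma univ_le_univ_univ: "\<^bold>\<forall>a \<le> \<^bold>\<forall>\<^bold>\<forall>a"
  by (metis univ_univ_imp univ_top imp_eq_top_iff order_refl)

lemma univ_univ: "\<^bold>\<forall>\<^bold>\<forall>a = \<^bold>\<forall>a"
  by (meson antisym order_trans univ_le_exis exis_univ_le univ_le_univ_univ)

lemma exis_univ: "\<^bold>\<exists>\<^bold>\<forall>a = \<^bold>\<forall>a"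
  by (metis antisym exis_univ_le univ_le_exis univ_univ)

lemma exis_exis: "\<^bold>\<exists>\<^bold>\<exists>a = \<^bold>\<exists>a"
proof -
  \<comment> \<open>With \<exists>\<top> = \<top>, the axiom \<open>exis_mult_exis\<close> at a =
    \<top> becomes idempotence.\<close>
  have "\<^bold>\<exists>\<top> = \<top>"
    by (metis univ_top exis_univ)
  then show ?thesis
    by (metis exis_mult_exis left_neutral)
qed

lemma univ_exis: "\<^bold>\<forall>\<^bold>\<exists>a = \<^bold>\<exists>a"
  by (metis antisym exis_exis exis_le_univ_exis univ_le_exis)

lemma univ_univ_imp_self: "\<^bold>\<forall>(\<^bold>\<forall>a \<^bold>\<rightarrow> a) = \<top>"
  by (simp add: univ_univ_imp imp_eq_top_iff)

text \<open>Every \<exists>b is of the form \<forall>c, namely with c = \<exists>b, so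
  \<open>univ_imp_univ\<close> applies.\<close>

lemma univ_imp_exis_eq: "\<^bold>\<forall>(a \<^bold>\<rightarrow> \<^bold>\<exists>b) = \<^bold>\<exists>a \<^bold>\<rightarrow> \<^bold>\<exists>b"
  by (metis univ_imp_univ univ_exis)

lemma univ_imp_exis_self: "\<^bold>\<forall>(a \<^bold>\<rightarrow> \<^bold>\<exists>a) = \<top>"
  by (simp add: univ_imp_exis_eq imp_eq_top_iff)

lemma univ_eq_top_mono: "\<^bold>\<forall>a = \<top> \<Longrightarrow> a \<le> b \<Longrightarrow> \<^bold>\<forall>b = \<top>"
  by (metis univ_mono top_le)

end

context godel_algebra
begin

lemma le_imp_iff: "a \<le> b \<^bold>\<rightarrow> c \<longleftrightarrow> a \<sqinter> b \<le> c"
  using residuation mult_eq_inf by simp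

text \<open>Contraction: since multiplication is the meet, x can serve for both premises at
  once.\<close>

lemma modus_ponens: "x \<le> a \<^bold>\<rightarrow> b \<Longrightarrow> x \<le> a \<Longrightarrow> x \<le> b"
  by (metis le_imp_iff inf.absorb1)

end

locale epistemic_godel_algebra =
  epistemic_bl_algebra mult imp univ exis + godel_algebra mult imp
  for mult :: "'a::bounded_lattice \<Rightarrow> 'a \<Rightarrow> 'a"  (infixl \<open>\<^bold>*\<close> 70)
    and imp :: "'a \<Rightarrow> 'a \<Rightarrow> 'a"  (infixr \<open>\<^bold>\<rightarrow>\<close> 60)
    and univ :: "'a \<Rightarrow> 'a"  (\<open>\<^bold>\<forall>_\<close> [90] 90)
    and exis :: "'a \<Rightarrow> 'a"  (\<open>\<^bold>\<exists>_\<close> [90] 90)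
begin

lemma exis_imp_univ_le: "\<^bold>\<exists>a \<^bold>\<rightarrow> \<^bold>\<forall>b \<le> \<^bold>\<forall>(a \<^bold>\<rightarrow> b)"
proof -
  let ?c = "\<^bold>\<exists>a \<^bold>\<rightarrow> \<^bold>\<forall>b"
  let ?h = "(a \<^bold>\<rightarrow> \<^bold>\<exists>a) \<sqinter> (\<^bold>\<forall>b \<^bold>\<rightarrow> b)"
  have "?h \<sqinter> ?c \<sqinter> a \<le> \<^bold>\<exists>a"
    by (rule modus_ponens[of _ a]) (simp_all add: le_infI1)
  then have "?h \<sqinter> ?c \<sqinter> a \<le> \<^bold>\<forall>b"
    by (rule modus_ponens[rotated]) (simp add: le_infI1)
  then have "?h \<sqinter> ?c \<sqinter> a \<le> b"
    by (rule modus_ponens[rotated]) (simp add: le_infI1)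
  then have "?h \<le> ?c \<^bold>\<rightarrow> a \<^bold>\<rightarrow> b"
    by (simp add: le_imp_iff)
  moreover have "\<^bold>\<forall>?h = \<top>"
    by (simp add: univ_inf univ_imp_exis_self univ_univ_imp_self)
  ultimately have "\<^bold>\<forall>(?c \<^bold>\<rightarrow> a \<^bold>\<rightarrow> b) = \<top>"
    by (rule univ_eq_top_mono[rotated])
  \<comment> \<open>By \<open>univ_imp_univ\<close>, \<open>?c\<close> equals \<forall>(a
    \<rightarrow> \<forall>b); as a value of \<forall> it can be pulled out by
    \<open>univ_univ_imp\<close>.\<close>
  moreover have "\<^bold>\<forall>(?c \<^bold>\<rightarrow> a \<^bold>\<rightarrow> b) = ?c \<^bold>\<rightarrow> \<^bold>\<forall>(a \<^bold>\<rightarrow> b)"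
    by (metis univ_imp_univ univ_univ_imp)
  ultimately show ?thesis
    by (simp add: imp_eq_top_iff)
qed

text \<open>Chaining with b \<rightarrow> \<exists>b under \<forall> gives \<forall>(a \<rightarrow>
  \<exists>b) = \<top>, and this element is \<exists>a \<rightarrow> \<exists>b. Monotonicity of
  \<exists> is the case a \<le> b.\<close>

lemma exis_le_exis_if_univ_imp:
  assumes "\<^bold>\<forall>(a \<^bold>\<rightarrow> b) = \<top>"
  shows "\<^bold>\<exists>a \<le> \<^bold>\<exists>b"
proof -
  let ?h = "(a \<^bold>\<rightarrow> b) \<sqinter> (b \<^bold>\<rightarrow> \<^bold>\<exists>b)"
  have "?h \<sqinter> a \<le> b"
    by (rule modus_ponens[of _ a]) (simp_all add: le_infI1)
  then have "?h \<sqinter> a \<le> \<^bold>\<exists>b"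
    by (rule modus_ponens[rotated]) (simp add: le_infI1)
  then have "?h \<le> a \<^bold>\<rightarrow> \<^bold>\<exists>b"
    by (simp add: le_imp_iff)
  moreover have "\<^bold>\<forall>?h = \<top>"
    by (simp add: univ_inf univ_imp_exis_self assms)
  ultimately have "\<^bold>\<forall>(a \<^bold>\<rightarrow> \<^bold>\<exists>b) = \<top>"
    by (rule univ_eq_top_mono[rotated])
  then show ?thesis
    by (simp add: univ_imp_exis_eq imp_eq_top_iff)
qed

lemma exis_imp_le: "\<^bold>\<exists>(a \<^bold>\<rightarrow> b) \<le> \<^bold>\<forall>a \<^bold>\<rightarrow> \<^bold>\<exists>b"
proof -
  \<comment> \<open>By residuation the goal is \<exists>(a \<rightarrow> b) \<sqinter> \<forall>a
    \<le> \<exists>b; \<open>?x\<close> is chosen so that \<exists> of it is the left side.\<close>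
  let ?x = "(a \<^bold>\<rightarrow> b) \<sqinter> \<^bold>\<forall>a"
  have "(\<^bold>\<forall>a \<^bold>\<rightarrow> a) \<sqinter> ?x \<le> a"
    by (rule modus_ponens[of _ "\<^bold>\<forall>a"]) (simp_all add: le_infI2)
  then have "(\<^bold>\<forall>a \<^bold>\<rightarrow> a) \<sqinter> ?x \<le> b"
    by (rule modus_ponens[rotated]) (simp add: le_infI2)
  then have "\<^bold>\<forall>a \<^bold>\<rightarrow> a \<le> ?x \<^bold>\<rightarrow> b"
    by (simp add: le_imp_iff)
  with univ_univ_imp_self have "\<^bold>\<forall>(?x \<^bold>\<rightarrow> b) = \<top>"
    by (rule univ_eq_top_mono)
  then have "\<^bold>\<exists>?x \<le> \<^bold>\<exists>b"
    by (rule exis_le_exis_if_univ_imp)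
  \<comment> \<open>Since \<forall>a = \<exists>\<forall>a, the factor \<forall>a leaves the scope
    of \<exists> by \<open>exis_mult_exis\<close>.\<close>
  moreover have "\<^bold>\<exists>?x = \<^bold>\<exists>(a \<^bold>\<rightarrow> b) \<sqinter> \<^bold>\<forall>a"
    by (metis exis_mult_exis exis_univ mult_eq_inf)
  ultimately show ?thesis
    by (simp add: le_imp_iff)
qed

sublocale bimodal_godel_algebra mult imp univ exis
proof
  show "\<^bold>\<forall>(a \<^bold>* b) = \<^bold>\<forall>a \<^bold>* \<^bold>\<forall>b" for a b
    by (simp add: mult_eq_inf univ_inf)
\<comment> \<open>The inequalities (G8) and (G9) hold as equalities, so rewriting reduces them to
  reflexivity.\<close>
qed (simp_all add: univ_top exis_imp_univ_le exis_sup exis_bot exis_imp_le univ_le_exis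
    univ_univ exis_exis univ_exis exis_univ)

end

theorem theorem5:
  fixes mult :: "'a::bounded_lattice \<Rightarrow> 'a \<Rightarrow> 'a"  (infixl \<open>\<^bold>*\<close> 70)
    and imp :: "'a \<Rightarrow> 'a \<Rightarrow> 'a"  (infixr \<open>\<^bold>\<rightarrow>\<close> 60)
    and univ :: "'a \<Rightarrow> 'a"  (\<open>\<^bold>\<forall>_\<close> [90] 90)
    and exis :: "'a \<Rightarrow> 'a"  (\<open>\<^bold>\<exists>_\<close> [90] 90)
  assumes "epistemic_bl_algebra mult imp univ exis"
    and "godel_algebra mult imp"
  shows "(\<forall>a b.
        \<^bold>\<forall>(a \<^bold>* b) = \<^bold>\<forall>a \<^bold>* \<^bold>\<forall>b
      \<and> \<^bold>\<forall>\<top> = \<top>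
      \<and> \<^bold>\<exists>a \<^bold>\<rightarrow> \<^bold>\<forall>b \<le> \<^bold>\<forall>(a \<^bold>\<rightarrow> b)
      \<and> \<^bold>\<exists>(a \<squnion> b) = \<^bold>\<exists>a \<squnion> \<^bold>\<exists>b
      \<and> \<^bold>\<exists>\<bottom> = \<bottom>
      \<and> \<^bold>\<exists>(a \<^bold>\<rightarrow> b) \<le> \<^bold>\<forall>a \<^bold>\<rightarrow> \<^bold>\<exists>b
      \<and> \<^bold>\<forall>a \<le> \<^bold>\<exists>a
      \<and> (\<^bold>\<forall>a \<le> \<^bold>\<forall>\<^bold>\<forall>a \<and> \<^bold>\<exists>a \<le> \<^bold>\<exists>\<^bold>\<exists>a)
      \<and> (\<^bold>\<exists>a \<le> \<^bold>\<forall>\<^bold>\<exists>a \<and> \<^bold>\<exists>\<^bold>\<forall>a \<le> \<^bold>\<forall>a))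
    \<and> bimodal_godel_algebra mult imp univ exis"
proof -
  interpret epistemic_godel_algebra mult imp univ exis
    using assms by (simp add: epistemic_godel_algebra_def)
  show ?thesis
    using bimodal_godel_algebra_axioms G1 G2 G3 G4 G5 G6 G7 G8 G9 by blast
qed

end
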